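(* Let $n \ge 3$ and let $\mathcal{O}_n$ be the semigroup of order-preserving singular selfmaps of $[n] = \{1, 2, \ldots, n\}$. Then $$r_5(\mathcal{O}_n) = \binom{2n-1}{n-1} - n + 1.$$
   Context: Let $[n] = \{1, 2, \ldots, n\}$. Let $\mathrm{Sing}_n$ be the set of all singular maps (non-permutations) from $[n]$ to $[n]$. Maps are written on the right of their arguments ($x\alpha$ is the image of $x$ under $\alpha$) and products are compositions from left to right, $x(\alpha\beta) = (x\alpha)\beta$. The semigroup of order-preserving singular selfmaps is $$\mathcal{O}_n = \{\alpha \in \mathrm{Sing}_n : (\forall x, y \in [n])\; x \le y \Rightarrow x\alpha \le y\alpha\}$$ under composition. For a finite semigroup $\Gamma$, the large rank of $\Gamma$ is $$r_5(\Gamma) = \min\{k : \text{every subset } U \text{ of cardinality } k \text{ in } \Gamma \text{ generates } \Gamma\},$$ where a subset $U$ generates $\Gamma$ if the subsemigroup $\langle U \rangle$ generated by $U$ equals $\Gamma$. *)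

theory Defs
  imports Complex_Main "HOL-Library.FuncSet"
begin

text \<open>
  A semigroup is given by a carrier set and a binary operation. The subsemigroup generated by
  \<open>U\<close> is the least set containing \<open>U\<close> and closed under the operation; it is empty for empty \<open>U\<close>.
\<close>

inductive_set subsemigroup_generated :: "('a \<Rightarrow> 'a \<Rightarrow> 'a) \<Rightarrow> 'a set \<Rightarrow> 'a set"
  for mul :: "'a \<Rightarrow> 'a \<Rightarrow> 'a" and U :: "'a set"
where
  base: "x \<in> U \<Longrightarrow> x \<in> subsemigroup_generated mul U"
| mult: "\<lbrakk>x \<in> subsemigroup_generated mul U; y \<in> subsemigroup_generated mul U\<rbrakk>
          \<Longrightarrow> mul x y \<in> subsemigroup_generated mul U"

text \<open>
  For finite \<open>S\<close> closed under \<open>mul\<close> the minimum exists, since \<open>k = card S\<close> has the property.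
\<close>

definition large_rank :: "('a \<Rightarrow> 'a \<Rightarrow> 'a) \<Rightarrow> 'a set \<Rightarrow> nat" where
  "large_rank mul S =
     (LEAST k. \<forall>U. U \<subseteq> S \<and> card U = k \<longrightarrow> subsemigroup_generated mul U = S)"

text \<open>
  Selfmaps of \<open>{1..n}\<close> are represented by functions that are \<open>undefined\<close> outside \<open>{1..n}\<close>,
  so that distinct HOL functions are distinct maps.
\<close>

definition Sing :: "nat \<Rightarrow> (nat \<Rightarrow> nat) set" where
  "Sing n = {\<alpha> \<in> {1..n} \<rightarrow>\<^sub>E {1..n}. \<not> bij_betw \<alpha> {1..n} {1..n}}"

text \<open>Left-to-right composition: \<open>\<alpha>\<close> is applied first.\<close>

definition map_mult :: "nat \<Rightarrow> (nat \<Rightarrow> nat) \<Rightarrow> (nat \<Rightarrow> nat) \<Rightarrow> nat \<Rightarrow> nat" where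
  "map_mult n \<alpha> \<beta> = compose {1..n} \<beta> \<alpha>"

definition order_preserving_sing :: "nat \<Rightarrow> (nat \<Rightarrow> nat) set" where
  "order_preserving_sing n =
     {\<alpha> \<in> Sing n. \<forall>x\<in>{1..n}. \<forall>y\<in>{1..n}. x \<le> y \<longrightarrow> \<alpha> x \<le> \<alpha> y}"

end

theory Submission imports Defs begin

text \<open>
  The large rank exceeds by one the largest size of a proper subsemigroup. The order-preserving
  maps of rank \<open>n - 1\<close> form a grid \<open>D i j\<close>, where \<open>i\<close> and \<open>i + 1\<close> are merged and \<open>j\<close> is missed,
  with \<open>D i k \<cdot> D l j = D i j\<close> whenever \<open>k \<in> {l, l + 1}\<close>. Deleting a column (the \<open>n - 1\<close> maps that
  miss a given point) leaves a proper subsemigroup. Conversely, if \<open>D i j\<close> is not in a subsemigroup,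
  then for each \<open>l \<noteq> i\<close> one of \<open>D i k\<close> and \<open>D l j\<close> is not either, where \<open>k\<close> is matched with \<open>l\<close>;
  so at least \<open>n - 1\<close> elements are missing. A subsemigroup that contains the whole grid is
  everything, since every non-identity order-preserving map factors as a grid element followed by
  a map closer to the identity.
\<close>

section \<open>Counting order-preserving maps between finite chains\<close>

text \<open>Domain and codomain have separate sizes because the counting recursion lowers one at a
  time. For \<open>m = n\<close> the identity is included.\<close>

definition order_preserving_maps :: "nat \<Rightarrow> nat \<Rightarrow> (nat \<Rightarrow> nat) set" where
  "order_preserving_maps n m = {f \<in> {1..n} \<rightarrow>\<^sub>E {1..m}. mono_on {1..n} f}"

lemma order_preserving_mapsI:
  assumes "\<And>x. x \<in> {1..n} \<Longrightarrow> f x \<in> {1..m}" "\<And>x. x \<notin> {1..n} \<Longrightarrow> f x = undefined"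
    "\<And>x. 1 \<le> x \<Longrightarrow> Suc x \<le> n \<Longrightarrow> f x \<le> f (Suc x)"
  shows "f \<in> order_preserving_maps n m"
proof -
  have "f x \<le> f y" if "1 \<le> x" "x \<le> y" "y \<le> n" for x y
    using that(2,1,3)
  proof (induction y rule: dec_induct)
    case (step y)
    then show ?case using assms(3)[of y] by linarith
  qed simp
  then show ?thesis
    unfolding order_preserving_maps_def using assms(1,2) by (auto simp: mono_on_def PiE_iff extensional_def)
qed

lemma order_preserving_mapsD:
  assumes "f \<in> order_preserving_maps n m"
  shows "x \<in> {1..n} \<Longrightarrow> f x \<in> {1..m}" "x \<notin> {1..n} \<Longrightarrow> f x = undefined"
    "1 \<le> x \<Longrightarrow> x \<le> y \<Longrightarrow> y \<le> n \<Longrightarrow> f x \<le> f y"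
  using assms by (auto simp: order_preserving_maps_def mono_on_def PiE_iff extensional_def)

lemma finite_order_preserving_maps: "finite (order_preserving_maps n m)"
  by (rule finite_subset[of _ "{1..n} \<rightarrow>\<^sub>E {1..m}"])
    (auto simp: order_preserving_maps_def intro: finite_PiE)

text \<open>Split by whether the last point takes the top value. If it does not, monotonicity keeps
  every value below the top; if it does, it puts no constraint on the other values.\<close>

lemma order_preserving_maps_Suc:
  "order_preserving_maps (Suc n) (Suc m) =
    order_preserving_maps (Suc n) m \<union> (\<lambda>f. f(Suc n := Suc m)) ` order_preserving_maps n (Suc m)"
proof (intro equalityI subsetI)
  fix f assume f: "f \<in> order_preserving_maps (Suc n) (Suc m)"
  note fD = order_preserving_mapsD[OF f]
  show "f \<in> order_preserving_maps (Suc n) m \<union>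
      (\<lambda>f. f(Suc n := Suc m)) ` order_preserving_maps n (Suc m)"
  proof (cases "f (Suc n) = Suc m")
    case True
    have "f(Suc n := undefined) \<in> order_preserving_maps n (Suc m)"
      using fD by (intro order_preserving_mapsI) auto
    moreover have "f = (f(Suc n := undefined))(Suc n := Suc m)"
      using True by auto
    ultimately show ?thesis by blast
  next
    case False
    have "f x \<in> {1..m}" if "x \<in> {1..Suc n}" for x
      using fD(1)[OF that] fD(1)[of "Suc n"] fD(3)[of x "Suc n"] False that by auto
    then have "f \<in> order_preserving_maps (Suc n) m"
      using fD by (intro order_preserving_mapsI) auto
    then show ?thesis by blast
  qed
next
  fix f assume "f \<in> order_preserving_maps (Suc n) m \<union>
      (\<lambda>f. f(Suc n := Suc m)) ` order_preserving_maps n (Suc m)"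
  then show "f \<in> order_preserving_maps (Suc n) (Suc m)"
  proof
    assume f: "f \<in> order_preserving_maps (Suc n) m"
    note fD = order_preserving_mapsD[OF f]
    show ?thesis
      using fD by (intro order_preserving_mapsI) (auto simp: le_Suc_eq)
  next
    assume "f \<in> (\<lambda>f. f(Suc n := Suc m)) ` order_preserving_maps n (Suc m)"
    then obtain g where g: "g \<in> order_preserving_maps n (Suc m)" "f = g(Suc n := Suc m)"
      by blast
    note gD = order_preserving_mapsD[OF g(1)]
    show ?thesis
      unfolding g(2) using gD by (intro order_preserving_mapsI) (auto simp: le_Suc_eq)
  qed
qed

text \<open>The two alternatives of \<open>order_preserving_maps_Suc\<close> are disjoint, so the
  counts obey Pascal's rule.\<close>

lemma card_order_preserving_maps:
  "card (order_preserving_maps n (Suc m)) = (n + m) choose n"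
proof (induction "n + m" arbitrary: n m)
  case 0
  then show ?case by (simp add: order_preserving_maps_def)
next
  case (Suc k)
  show ?case
  proof (cases n)
    case 0
    then show ?thesis by (simp add: order_preserving_maps_def mono_on_def)
  next
    case n: (Suc n')
    let ?A = "order_preserving_maps (Suc n') m"
    let ?h = "\<lambda>f::nat \<Rightarrow> nat. f(Suc n' := Suc m)"
    let ?B = "?h ` order_preserving_maps n' (Suc m)"
    have "inj_on ?h (order_preserving_maps n' (Suc m))"
    proof (rule inj_onI)
      fix f g assume f: "f \<in> order_preserving_maps n' (Suc m)"
        and g: "g \<in> order_preserving_maps n' (Suc m)" and eq: "?h f = ?h g"
      \<comment> \<open>The extension overwrites only an \<open>undefined\<close> value, so it loses
        no information.\<close>
      have "f (Suc n') = g (Suc n')"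
        using order_preserving_mapsD(2)[OF f] order_preserving_mapsD(2)[OF g] by simp
      then show "f = g"
        using eq by (metis fun_upd_triv fun_upd_upd)
    qed
    then have B: "card ?B = (n' + m) choose n'"
      using Suc n by (simp add: card_image)
    have A: "card ?A = (n' + m) choose (Suc n')"
    proof (cases m)
      case 0
      have "?A = {}" by (auto simp: order_preserving_maps_def 0 PiE_eq_empty_iff)
      then show ?thesis by (simp add: 0)
    next
      case (Suc m')
      then show ?thesis using Suc.hyps(1)[of n m'] Suc.hyps(2) n by simp
    qed
    have "?A \<inter> ?B = {}"
    proof -
      have False if "f \<in> ?A" "f (Suc n') = Suc m" for f
        using order_preserving_mapsD(1)[OF that(1), of "Suc n'"] that(2) by simp
      then show ?thesis by force
    qed
    then have "card (?A \<union> ?B) = card ?A + card ?B"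
      by (simp add: card_Un_disjoint finite_order_preserving_maps)
    then show ?thesis
      by (simp add: n order_preserving_maps_Suc A B)
  qed
qed

section \<open>The identity and composition\<close>

definition ident :: "nat \<Rightarrow> nat \<Rightarrow> nat" where
  "ident n = (\<lambda>x\<in>{1..n}. x)"

lemma ident_mem: "ident n \<in> order_preserving_maps n n"
  by (rule order_preserving_mapsI) (auto simp: ident_def)

lemma map_mult_apply: "x \<in> {1..n} \<Longrightarrow> map_mult n f g x = g (f x)"
  by (simp add: map_mult_def compose_def)

lemma map_mult_ident:
  assumes "f \<in> order_preserving_maps n n"
  shows "map_mult n f (ident n) = f"
proof
  fix x
  show "map_mult n f (ident n) x = f x"
  proof (cases "x \<in> {1..n}")
    case True
    then show ?thesis
      using order_preserving_mapsD(1)[OF assms True] by (simp add: map_mult_apply ident_def)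
  next
    case False
    then show ?thesis
      using order_preserving_mapsD(2)[OF assms False]
      by (simp add: map_mult_def compose_def del: atLeastAtMost_iff)
  qed
qed

lemma map_mult_mem:
  assumes "f \<in> order_preserving_maps n n" "g \<in> order_preserving_maps n n"
  shows "map_mult n f g \<in> order_preserving_maps n n"
proof (rule order_preserving_mapsI)
  fix x assume "1 \<le> x" "Suc x \<le> n"
  then show "map_mult n f g x \<le> map_mult n f g (Suc x)"
    using order_preserving_mapsD[OF assms(1)] order_preserving_mapsD(3)[OF assms(2)]
    by (simp add: map_mult_apply)
next
  fix x assume "x \<in> {1..n}"
  then show "map_mult n f g x \<in> {1..n}"
    using order_preserving_mapsD(1)[OF assms(1)] order_preserving_mapsD(1)[OF assms(2)]
    by (simp add: map_mult_apply)
qed (auto simp: map_mult_def compose_def)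

section \<open>The grid of maps of rank \<open>n - 1\<close>\<close>

text \<open>
  The composite of the degeneracy \<open>{1..n} \<rightarrow> {1..n-1}\<close> merging \<open>i\<close> and \<open>i + 1\<close> with the face map
  \<open>{1..n-1} \<rightarrow> {1..n}\<close> missing \<open>j\<close>.
\<close>

definition defect1 :: "nat \<Rightarrow> nat \<Rightarrow> nat \<Rightarrow> nat \<Rightarrow> nat" where
  "defect1 n i j = (\<lambda>x\<in>{1..n}. let y = if x \<le> i then x else x - 1 in if y < j then y else y + 1)"

lemma defect1_mem:
  assumes "i \<in> {1..<n}" "j \<in> {1..n}"
  shows "defect1 n i j \<in> order_preserving_maps n n"
  using assms by (intro order_preserving_mapsI) (auto simp: defect1_def Let_def)

text \<open>A simplicial identity: the face map missing \<open>k\<close>, followed by the degeneracy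
  merging \<open>l\<close> and \<open>l + 1\<close>, is the identity on \<open>n - 1\<close> points,
  so the two inner factors cancel.\<close>

lemma defect1_mult:
  assumes "i \<in> {1..<n}" "k = l \<or> k = Suc l"
  shows "map_mult n (defect1 n i k) (defect1 n l j) = defect1 n i j"
proof
  fix x
  show "map_mult n (defect1 n i k) (defect1 n l j) x = defect1 n i j x"
  proof (cases "x \<in> {1..n}")
    case True
    define y where "y = (if x \<le> i then x else x - 1)"
    define z where "z = (if y < k then y else y + 1)"
    have y: "y \<in> {1..<n}"
      using True assms(1) by (auto simp: y_def)
    have ik: "defect1 n i k x = z" and ij: "defect1 n i j x = (if y < j then y else y + 1)"
      using True by (simp_all add: defect1_def Let_def y_def z_def)
    have "z \<in> {1..n}" "(if z \<le> l then z else z - 1) = y"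
      using y assms(2) by (auto simp: z_def)
    then have "defect1 n l j z = (if y < j then y else y + 1)"
      by (simp add: defect1_def)
    then show ?thesis
      using True by (simp add: map_mult_apply ik ij)
  qed (simp add: map_mult_def compose_def defect1_def del: atLeastAtMost_iff)
qed

lemma defect1_image:
  assumes "i \<in> {1..<n}" "j \<in> {1..n}"
  shows "defect1 n i j ` {1..n} = {1..n} - {j}"
proof (intro equalityI subsetI)
  fix y assume "y \<in> defect1 n i j ` {1..n}"
  then show "y \<in> {1..n} - {j}"
    using assms by (auto simp: defect1_def Let_def split: if_splits)
next
  fix y assume y: "y \<in> {1..n} - {j}"
  \<comment> \<open>\<open>z\<close> undoes the face map, and \<open>x\<close> is a preimage of
    \<open>z\<close> under the degeneracy.\<close>
  define z where "z = (if y < j then y else y - 1)"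
  define x where "x = (if z \<le> i then z else z + 1)"
  have "x \<in> {1..n}" "defect1 n i j x = y"
    using y assms by (auto simp: x_def z_def defect1_def Let_def)
  then show "y \<in> defect1 n i j ` {1..n}" by blast
qed

text \<open>The image determines \<open>j\<close> as its missing point; the only adjacent pair with
  equal values determines \<open>i\<close>.\<close>

lemma defect1_eq_iff:
  assumes "i \<in> {1..<n}" "j \<in> {1..n}" "i' \<in> {1..<n}" "j' \<in> {1..n}"
  shows "defect1 n i j = defect1 n i' j' \<longleftrightarrow> i = i' \<and> j = j'"
proof
  assume eq: "defect1 n i j = defect1 n i' j'"
  have "{1..n} - {j} = {1..n} - {j'}"
    using defect1_image[OF assms(1,2)] defect1_image[OF assms(3,4)] eq by simp
  then have "j = j'" using assms by blast
  have "defect1 n i j i = defect1 n i j (Suc i)"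
    using assms by (simp add: defect1_def)
  then have "defect1 n i' j' i = defect1 n i' j' (Suc i)"
    by (simp add: eq)
  then have "i = i'"
    using assms by (auto simp: defect1_def Let_def split: if_splits)
  with \<open>j = j'\<close> show "i = i' \<and> j = j'" by simp
qed simp

section \<open>Moving a map towards the identity\<close>

text \<open>
  For \<open>f z > z\<close> with \<open>z\<close> greatest possible, \<open>f z = f (z + 1) = z + 1\<close>; the value at the least
  point of this fibre can be lowered. Dually for \<open>f z < z\<close>.
\<close>

lemma closer_to_ident:
  assumes f: "f \<in> order_preserving_maps n n" and "f \<noteq> ident n"
  obtains x x' v where "x \<in> {1..n}" "x' \<in> {1..n}" "x' = Suc x \<or> x = Suc x'" "f x' = f x"
    "f(x := v) \<in> order_preserving_maps n n" "\<bar>int v - int x\<bar> < \<bar>int (f x) - int x\<bar>"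
proof -
  note fD = order_preserving_mapsD[OF f]
  obtain x0 where "f x0 \<noteq> ident n x0" using assms(2) by blast
  then have x0: "x0 \<in> {1..n}" "f x0 \<noteq> x0"
    using fD(2)[of x0] by (auto simp: ident_def split: if_splits)
  consider "f x0 > x0" | "f x0 < x0" using x0(2) by linarith
  then show ?thesis
  proof cases
    case 1
    let ?P = "\<lambda>z. z \<in> {1..n} \<and> f z > z"
    define z where "z = (GREATEST z. ?P z)"
    have z: "?P z"
      unfolding z_def by (rule GreatestI_nat[of ?P x0 n]) (use 1 x0 in auto)
    have zmax: "y \<le> z" if "?P y" for y
      unfolding z_def by (rule Greatest_le_nat[of ?P _ n]) (use that in auto)
    have zn: "Suc z \<le> n" using fD(1)[of z] z by auto
    have fSz: "f (Suc z) = Suc z" "f z = Suc z"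
      using zmax[of "Suc z"] zn z fD(3)[of z "Suc z"] by force+
    let ?Q = "\<lambda>x. x \<in> {1..n} \<and> f x = Suc z"
    define x where "x = (LEAST x. ?Q x)"
    have x: "?Q x" unfolding x_def by (rule LeastI[of ?Q z]) (use fSz z in auto)
    have xz: "x \<le> z" unfolding x_def by (rule Least_le) (use fSz z in auto)
    have xmin: "x \<le> y" if "?Q y" for y unfolding x_def using that by (rule Least_le)
    have fx: "f (Suc x) = Suc z"
      using fD(3)[of x "Suc x"] fD(3)[of "Suc x" "Suc z"] x xz zn fSz by auto
    have below: "f y \<le> z" if "1 \<le> y" "y < x" for y
      using fD(3)[of y x] xmin[of y] that x by force
    \<comment> \<open>Since \<open>x \<le> z\<close>, lowering the value from \<open>Suc z\<close>
      to \<open>z\<close> brings it one closer to \<open>x\<close>. Order survives because all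
      earlier values are at most \<open>z\<close>.\<close>
    have "f(x := z) \<in> order_preserving_maps n n"
      using fD z x xz fx zn below by (intro order_preserving_mapsI) auto
    then show ?thesis
      using that[of x "Suc x" z] x xz zn fx by auto
  next
    case 2
    let ?P = "\<lambda>z. z \<in> {1..n} \<and> f z < z"
    define w where "w = (LEAST z. ?P z)"
    have w: "?P w" unfolding w_def by (rule LeastI[of ?P x0]) (use 2 x0 in auto)
    have wmin: "w \<le> y" if "?P y" for y unfolding w_def using that by (rule Least_le)
    have "w \<ge> 2" using fD(1)[of w] w by auto
    then obtain z where wz: "w = Suc z" "z \<ge> 1" by (cases w) auto
    have fz: "f z = z" "f (Suc z) = z"
      using wmin[of z] w fD(3)[of z "Suc z"] wz by force+
    let ?Q = "\<lambda>x. x \<in> {1..n} \<and> f x = z"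
    define x where "x = (GREATEST x. ?Q x)"
    have x: "?Q x"
      unfolding x_def by (rule GreatestI_nat[of ?Q w n]) (use fz w wz in auto)
    have xmax: "y \<le> x" if "?Q y" for y
      unfolding x_def by (rule Greatest_le_nat[of ?Q _ n]) (use that in auto)
    have xz: "Suc z \<le> x" using xmax[of w] w wz fz by simp
    then obtain x' where x': "x = Suc x'" "x' \<ge> z" by (cases x) auto
    have fx: "f x' = z"
      using fD(3)[of x' x] fD(3)[of z x'] x x' fz wz by auto
    have above: "Suc z \<le> f y" if "y \<le> n" "x < y" for y
      using fD(3)[of x y] xmax[of y] that x by force
    have "f(x := Suc z) \<in> order_preserving_maps n n"
    proof (rule order_preserving_mapsI)
      fix y assume "1 \<le> y" "Suc y \<le> n"
      then show "(f(x := Suc z)) y \<le> (f(x := Suc z)) (Suc y)"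
        using fD(3)[of y "Suc y"] above[of "Suc y"] x by auto
    qed (use fD x xz in auto)
    then show ?thesis
      using that[of x x' "Suc z"] x xz x' fx wz by auto
  qed
qed

section \<open>Singular maps and their products\<close>

text \<open>By \<open>closer_to_ident\<close>, an order-preserving map other than the identity takes
  equal values at two adjacent points, hence is not injective.\<close>

lemma order_preserving_sing_eq:
  "order_preserving_sing n = order_preserving_maps n n - {ident n}"
proof -
  have "bij_betw (ident n) {1..n} {1..n}"
    by (rule bij_betw_cong[THEN iffD1, OF _ bij_betw_id]) (simp add: ident_def)
  moreover have "\<not> bij_betw f {1..n} {1..n}"
    if f: "f \<in> order_preserving_maps n n" "f \<noteq> ident n" for f
  proof -
    obtain x x' where "x \<in> {1..n}" "x' \<in> {1..n}" "x \<noteq> x'" "f x' = f x"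
      using closer_to_ident[OF f] by (metis n_not_Suc_n)
    then show ?thesis
      unfolding bij_betw_def inj_on_def by metis
  qed
  ultimately show ?thesis
    using ident_mem[of n]
    by (auto simp: order_preserving_sing_def Sing_def order_preserving_maps_def mono_on_def)
qed

text \<open>A product inherits every coincidence of values from its left factor, so it cannot be the
  identity.\<close>

lemma map_mult_mem_sing:
  assumes f: "f \<in> order_preserving_sing n" and g: "g \<in> order_preserving_sing n"
  shows "map_mult n f g \<in> order_preserving_sing n"
proof -
  have f': "f \<in> order_preserving_maps n n" "f \<noteq> ident n" and g': "g \<in> order_preserving_maps n n"
    using f g by (auto simp: order_preserving_sing_eq)
  obtain x x' where x: "x \<in> {1..n}" "x' \<in> {1..n}" "x \<noteq> x'" "f x' = f x"
    using closer_to_ident[OF f'] by (metis n_not_Suc_n)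
  then have "map_mult n f g x = map_mult n f g x'"
    by (simp add: map_mult_apply)
  then have "map_mult n f g \<noteq> ident n"
    using x by (auto simp: ident_def)
  then show ?thesis
    using map_mult_mem[OF f'(1) g'] by (simp add: order_preserving_sing_eq)
qed

lemma subsemigroup_generated_least:
  assumes "U \<subseteq> V" "\<And>x y. x \<in> V \<Longrightarrow> y \<in> V \<Longrightarrow> mul x y \<in> V"
  shows "subsemigroup_generated mul U \<subseteq> V"
proof
  fix x assume "x \<in> subsemigroup_generated mul U"
  then show "x \<in> V" by induction (use assms in auto)
qed

lemma defect1_mem_sing:
  assumes "i \<in> {1..<n}" "j \<in> {1..n}"
  shows "defect1 n i j \<in> order_preserving_sing n"
proof -
  have "defect1 n i j i = defect1 n i j (Suc i)"
    using assms by (simp add: defect1_def)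
  then have "defect1 n i j \<noteq> ident n"
    using assms by (auto simp: ident_def)
  then show ?thesis
    using defect1_mem[OF assms] by (simp add: order_preserving_sing_eq)
qed

section \<open>Generation by the grid\<close>

text \<open>Moving one point onto a neighbour and fixing the rest merges that pair and misses the
  moved point. These idempotents are the left factors in the factorization below.\<close>

lemma collapse_eq_defect1:
  assumes "x \<in> {1..n}" "x' \<in> {1..n}" "x' = Suc x \<or> x = Suc x'"
  shows "(ident n)(x := x') = defect1 n (min x x') x"
proof
  fix y
  show "((ident n)(x := x')) y = defect1 n (min x x') x y"
    using assms by (cases "y \<in> {1..n}") (auto simp: ident_def defect1_def Let_def)
qed

text \<open>Induction on the total displacement, the sum of all distances between \<open>f y\<close>
  and \<open>y\<close>.\<close>

lemma defect1_generate:
  assumes closed: "\<And>f g. f \<in> T \<Longrightarrow> g \<in> T \<Longrightarrow> map_mult n f g \<in> T"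
    and grid: "\<And>i j. i \<in> {1..<n} \<Longrightarrow> j \<in> {1..n} \<Longrightarrow> defect1 n i j \<in> T"
    and "f \<in> order_preserving_sing n"
  shows "f \<in> T"
proof -
  have "f \<in> T" if "f \<in> order_preserving_maps n n" "f \<noteq> ident n" for f
    using that
  proof (induction "nat (\<Sum>y\<in>{1..n}. \<bar>int (f y) - int y\<bar>)" arbitrary: f rule: less_induct)
    case less
    obtain x x' v where x: "x \<in> {1..n}" "x' \<in> {1..n}" "x' = Suc x \<or> x = Suc x'" "f x' = f x"
      and g: "f(x := v) \<in> order_preserving_maps n n"
      and v: "\<bar>int v - int x\<bar> < \<bar>int (f x) - int x\<bar>"
      using closer_to_ident[OF less.prems] by blast
    \<comment> \<open>\<open>e\<close> sends \<open>x\<close> to \<open>x'\<close>, where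
      \<open>f\<close> has the same value, so composing with \<open>e\<close> first hides the change
      of \<open>f\<close> at \<open>x\<close>.\<close>
    define e where "e = (ident n)(x := x')"
    have e: "e \<in> T"
      unfolding e_def collapse_eq_defect1[OF x(1-3)] using x by (intro grid) auto
    have fe: "f = map_mult n e (f(x := v))"
    proof
      fix y
      show "f y = map_mult n e (f(x := v)) y"
      proof (cases "y \<in> {1..n}")
        case True
        then have "e y = (if y = x then x' else y)"
          by (simp add: e_def ident_def)
        moreover have "x' \<noteq> x" using x(3) by auto
        ultimately show ?thesis
          using True x(4) by (simp add: map_mult_apply)
      next
        case False
        then show ?thesis
          using order_preserving_mapsD(2)[OF less.prems(1) False]
          by (simp add: map_mult_def compose_def del: atLeastAtMost_iff)
      qed
    qed
    show ?case
    \<comment> \<open>The induction hypothesis excludes the identity; in that case \<open>f\<close>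
      is the grid element \<open>e\<close> itself.\<close>
    proof (cases "f(x := v) = ident n")
      case True
      have "e \<in> order_preserving_maps n n"
        unfolding e_def collapse_eq_defect1[OF x(1-3)] using x by (intro defect1_mem) auto
      then have "f = e"
        using fe True map_mult_ident by metis
      then show ?thesis using e by simp
    next
      case False
      have "(\<Sum>y\<in>{1..n}. \<bar>int ((f(x := v)) y) - int y\<bar>) < (\<Sum>y\<in>{1..n}. \<bar>int (f y) - int y\<bar>)"
        by (rule sum_strict_mono_ex1) (use v x in auto)
      moreover have "0 \<le> (\<Sum>y\<in>{1..n}. \<bar>int ((f(x := v)) y) - int y\<bar>)"
        by (rule sum_nonneg) simp
      ultimately have "f(x := v) \<in> T"
        by (intro less.hyps[OF _ g False]) linarith
      then show ?thesis using closed[OF e] fe by metis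
    qed
  qed
  then show ?thesis using assms(3) by (simp add: order_preserving_sing_eq)
qed

section \<open>Elements missing from a proper subsemigroup\<close>

lemma card_compl_subsemigroup:
  assumes closed: "\<And>f g. f \<in> T \<Longrightarrow> g \<in> T \<Longrightarrow> map_mult n f g \<in> T"
    and proper: "\<not> order_preserving_sing n \<subseteq> T"
  shows "n - 1 \<le> card (order_preserving_sing n - T)"
proof -
  have "\<not> (\<forall>i\<in>{1..<n}. \<forall>j\<in>{1..n}. defect1 n i j \<in> T)"
  proof
    assume "\<forall>i\<in>{1..<n}. \<forall>j\<in>{1..n}. defect1 n i j \<in> T"
    then have "f \<in> T" if "f \<in> order_preserving_sing n" for f
      using defect1_generate[of T n f] closed that by simp
    then show False using proper by blast
  qed
  then obtain i j where i: "i \<in> {1..<n}" and j: "j \<in> {1..n}" and ij: "defect1 n i j \<notin> T"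
    by blast
  \<comment> \<open>\<open>k\<close> enumerates the \<open>n - 1\<close> columns other than
    \<open>j\<close>, with \<open>k l\<close> equal to \<open>l\<close> or \<open>l + 1\<close> as
    the product rule of the grid demands.\<close>
  define k where "k l = (if l < j then l else Suc l)" for l
  have k: "k l \<in> {1..n}" "k l \<noteq> j" if "l \<in> {1..<n}" for l
    using that by (auto simp: k_def)
  have k_inj: "k l = k l' \<longleftrightarrow> l = l'" for l l'
    by (auto simp: k_def)
  \<comment> \<open>\<open>h l\<close> picks a missing factor from row \<open>i\<close> or column
    \<open>j\<close>, and \<open>h i\<close> is the missing element \<open>defect1 n i j\<close>.
    Row and column meet only there, and \<open>k\<close> is injective, so the choices are
    distinct.\<close>
  define h where "h l = (if l \<noteq> i \<and> defect1 n i (k l) \<notin> T then defect1 n i (k l)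
    else defect1 n l j)" for l
  have h: "h l \<in> order_preserving_sing n - T" if l: "l \<in> {1..<n}" for l
  proof -
    have "map_mult n (defect1 n i (k l)) (defect1 n l j) = defect1 n i j"
      by (rule defect1_mult) (use i in \<open>auto simp: k_def\<close>)
    then have "defect1 n i (k l) \<notin> T \<or> defect1 n l j \<notin> T"
      using closed[of "defect1 n i (k l)" "defect1 n l j"] ij by auto
    then have "h l \<notin> T" using ij by (auto simp: h_def)
    then show ?thesis
      using i j l k by (auto simp: h_def intro: defect1_mem_sing)
  qed
  have "inj_on h {1..<n}"
  proof (rule inj_onI)
    fix l l' assume "l \<in> {1..<n}" "l' \<in> {1..<n}" "h l = h l'"
    then show "l = l'"
      using i j k[of l] k[of l'] k_inj[of l l']
      by (auto simp: h_def defect1_eq_iff split: if_splits)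
  qed
  then have "card {1..<n} \<le> card (order_preserving_sing n - T)"
    by (rule card_inj_on_le)
      (use h in \<open>auto simp: order_preserving_sing_eq finite_order_preserving_maps\<close>)
  then show ?thesis by simp
qed

section \<open>The subsemigroup without the first column\<close>

text \<open>Such a map climbs by at most one per step from \<open>2\<close> at \<open>1\<close> to
  \<open>n\<close> at \<open>n\<close>. So each point is fixed or shifted up by one, and the shifted
  points form an initial segment.\<close>

lemma image_missing_1_is_defect1:
  assumes f: "f \<in> order_preserving_maps n n" and im: "f ` {1..n} = {2..n}" and n: "n \<ge> 2"
  shows "f \<in> (\<lambda>i. defect1 n i 1) ` {1..<n}"
proof -
  note fD = order_preserving_mapsD[OF f]
  \<comment> \<open>No value from \<open>f y\<close> to \<open>f x\<close> is skipped, and by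
    monotonicity each is attained within \<open>{y..x}\<close>; comparing cardinalities bounds the
    slope by one.\<close>
  have slope: "f x + y \<le> x + f y" if "1 \<le> y" "y \<le> x" "x \<le> n" for x y
  proof -
    have "{f y..f x} \<subseteq> f ` {y..x}"
    proof
      fix w assume w: "w \<in> {f y..f x}"
      have "f y \<in> {2..n}" "f x \<in> {2..n}" using im that by auto
      then have "w \<in> f ` {1..n}" using w im by auto
      then obtain z where z: "z \<in> {1..n}" "w = f z" by blast
      have "w = f y" if "z \<le> y"
        using fD(3)[of z y] that z w \<open>y \<le> x\<close> \<open>x \<le> n\<close> by auto
      moreover have "w = f x" if "x \<le> z"
        using fD(3)[of x z] that z w \<open>1 \<le> y\<close> \<open>y \<le> x\<close> by auto
      ultimately show "w \<in> f ` {y..x}"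
        using z \<open>y \<le> x\<close> by (cases "z \<le> y"; cases "x \<le> z") auto
    qed
    then have "card {f y..f x} \<le> card {y..x}"
      by (meson card_image_le card_mono finite_atLeastAtMost finite_imageI le_trans)
    then show ?thesis using that by simp
  qed
  have f1: "f 1 = 2"
  proof -
    obtain z where "z \<in> {1..n}" "f z = 2" using im n by (metis atLeastAtMost_iff imageE order_refl)
    moreover have "f 1 \<in> {2..n}" using im n by auto
    ultimately show ?thesis using fD(3)[of 1 z] by auto
  qed
  have fn: "f n = n"
  proof -
    obtain z where "z \<in> {1..n}" "f z = n" using im n by (metis atLeastAtMost_iff imageE order_refl)
    moreover have "f n \<in> {2..n}" using im n by auto
    ultimately show ?thesis using fD(3)[of z n] by auto
  qed
  have range: "f x = x \<or> f x = Suc x" if "x \<in> {1..n}" for x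
    using slope[of 1 x] slope[of x n] f1 fn that by auto
  let ?P = "\<lambda>x. x \<in> {1..n} \<and> f x = Suc x"
  \<comment> \<open>The last shifted point is the one to merge with its successor;
    \<open>slope\<close> forces every earlier point to be shifted too.\<close>
  define k where "k = (GREATEST x. ?P x)"
  have k: "?P k"
    unfolding k_def by (rule GreatestI_nat[of ?P 1 n]) (use f1 n in auto)
  have kmax: "y \<le> k" if "?P y" for y
    unfolding k_def by (rule Greatest_le_nat[of ?P _ n]) (use that in auto)
  have "f = defect1 n k 1"
  proof
    fix x
    show "f x = defect1 n k 1 x"
    proof (cases "x \<in> {1..n}")
      case True
      then show ?thesis
        using range[OF True] kmax[of x] slope[of x k] k by (auto simp: defect1_def)
    qed (use fD(2) in \<open>simp add: defect1_def del: atLeastAtMost_iff\<close>)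
  qed
  moreover have "k \<in> {1..<n}" using k fn by (cases "k = n") auto
  ultimately show ?thesis by blast
qed

text \<open>The image of a product lies in that of its right factor. If the product misses only
  \<open>1\<close>, the singular factor \<open>g\<close> must have image \<open>{2..n}\<close> and
  thus lie in the deleted column. So the complement of the column is even a left ideal.\<close>

lemma closed_without_column:
  assumes "n \<ge> 2"
    and f: "f \<in> order_preserving_sing n"
    and g: "g \<in> order_preserving_sing n - (\<lambda>i. defect1 n i 1) ` {1..<n}"
  shows "map_mult n f g \<in> order_preserving_sing n - (\<lambda>i. defect1 n i 1) ` {1..<n}"
proof -
  have "map_mult n f g \<noteq> defect1 n i 1" if i: "i \<in> {1..<n}" for i
  proof
    assume eq: "map_mult n f g = defect1 n i 1"
    have "f x \<in> {1..n}" if "x \<in> {1..n}" for x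
      using f that by (auto simp: order_preserving_sing_def Sing_def)
    then have "map_mult n f g ` {1..n} \<subseteq> g ` {1..n}"
      by (auto simp: map_mult_apply simp del: atLeastAtMost_iff)
    moreover have "defect1 n i 1 ` {1..n} = {2..n}"
      by (subst defect1_image[OF i]) (use assms(1) in auto)
    ultimately have sub: "{2..n} \<subseteq> g ` {1..n}" by (simp add: eq)
    have g': "g \<in> {1..n} \<rightarrow>\<^sub>E {1..n}" "\<not> bij_betw g {1..n} {1..n}"
      using g by (auto simp: order_preserving_sing_def Sing_def)
    define R where "R = g ` {1..n}"
    have "R \<noteq> {1..n}"
      using g'(2) unfolding R_def
      by (metis bij_betw_def eq_card_imp_inj_on finite_atLeastAtMost)
    moreover have "R \<subseteq> {1..n}" using g'(1) by (auto simp: R_def)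
    moreover have "{1..n} = insert 1 {2..n}" using assms(1) by auto
    moreover have "{2..n} \<subseteq> R" using sub by (simp only: R_def)
    ultimately have "R = {2..n}" by (metis insert_absorb insert_subset subset_antisym subset_insert)
    then have "g ` {1..n} = {2..n}" by (simp only: R_def)
    then show False
      using image_missing_1_is_defect1[of g n] g assms(1) by (simp add: order_preserving_sing_eq)
  qed
  then show ?thesis
    using map_mult_mem_sing[OF f] g by blast
qed

section \<open>The large rank by counting\<close>

theorem theorem4p3:
  fixes n :: nat
  assumes "n \<ge> 3"
  shows "large_rank (map_mult n) (order_preserving_sing n)
           = ((2 * n - 1) choose (n - 1)) - n + 1"
proof -
  define S where "S = order_preserving_sing n"
  define W where "W = (\<lambda>i. defect1 n i 1) ` {1..<n}"
  define C where "C = (2 * n - 1) choose (n - 1)"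
  have finS: "finite S"
    by (simp add: S_def order_preserving_sing_eq finite_order_preserving_maps)
  have "card (order_preserving_maps n n) = (n + (n - 1)) choose n"
    using card_order_preserving_maps[of n "n - 1"] assms by simp
  also have "\<dots> = C"
    unfolding C_def using assms binomial_symmetric[of n "2 * n - 1"] by (simp add: mult_2)
  finally have cardS: "card S = C - 1"
    by (simp add: S_def order_preserving_sing_eq ident_mem finite_order_preserving_maps)
  have WS: "W \<subseteq> S"
    using assms by (auto simp: W_def S_def intro: defect1_mem_sing)
  have "inj_on (\<lambda>i. defect1 n i 1) {1..<n}"
    using assms by (auto intro!: inj_onI simp: defect1_eq_iff)
  then have cardW: "card W = n - 1"
    by (simp add: W_def card_image)
  \<comment> \<open>With \<open>n \<ge> 3\<close> this gives \<open>n \<le> C\<close>, so the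
    subtraction \<open>C - n\<close> is not truncated.\<close>
  have nC: "n - 1 \<le> C - 1"
    using card_mono[OF finS WS] cardS cardW by simp
  show ?thesis
    unfolding large_rank_def S_def[symmetric] C_def[symmetric]
  proof (rule Least_equality)
    show "\<forall>U. U \<subseteq> S \<and> card U = C - n + 1 \<longrightarrow> subsemigroup_generated (map_mult n) U = S"
    proof (intro allI impI)
      fix U assume U: "U \<subseteq> S \<and> card U = C - n + 1"
      let ?T = "subsemigroup_generated (map_mult n) U"
      have "S - ?T \<subseteq> S - U" by (auto intro: subsemigroup_generated.base)
      then have "card (S - ?T) \<le> card (S - U)" using finS by (intro card_mono) auto
      also have "card (S - U) = (C - 1) - (C - n + 1)"
        using U finS by (subst card_Diff_subset) (auto simp: cardS intro: finite_subset)
      \<comment> \<open>The difference is \<open>n - 2\<close>, one too few for the complement of a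
        proper subsemigroup.\<close>
      also have "\<dots> < n - 1" using nC assms by linarith
      finally have "S \<subseteq> ?T"
        using card_compl_subsemigroup[of ?T n] subsemigroup_generated.mult[of _ "map_mult n" U]
        unfolding S_def by (metis not_le)
      moreover have "?T \<subseteq> S"
        by (rule subsemigroup_generated_least) (use U map_mult_mem_sing S_def in auto)
      ultimately show "?T = S" by blast
    qed
  next
    fix k assume gen: "\<forall>U. U \<subseteq> S \<and> card U = k \<longrightarrow> subsemigroup_generated (map_mult n) U = S"
    show "C - n + 1 \<le> k"
    proof (rule ccontr)
      assume "\<not> C - n + 1 \<le> k"
      moreover have "card (S - W) = (C - 1) - (n - 1)"
        using WS finS by (subst card_Diff_subset) (auto simp: cardS cardW intro: finite_subset)
      ultimately have "k \<le> card (S - W)" using assms by linarith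
      \<comment> \<open>\<open>S - W\<close> has \<open>C - n\<close> elements, so it has room for a
        set of any smaller or equal size, which cannot generate \<open>W\<close>.\<close>
      then obtain U where U: "U \<subseteq> S - W" "card U = k"
        by (meson obtain_subset_with_card_n)
      have "subsemigroup_generated (map_mult n) U \<subseteq> S - W"
        by (rule subsemigroup_generated_least)
          (use U closed_without_column[of n] assms in \<open>auto simp: S_def W_def\<close>)
      then have "S \<subseteq> S - W" using gen U by blast
      moreover have "defect1 n 1 1 \<in> W" using assms by (auto simp: W_def)
      ultimately show False using WS by blast
    qed
  qed
qed

end
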